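(* Let $F>0$ and suppose that $$\phi''_{F}>0,\ \phi''_{2F}<0,\quad \rho'_{F}\le 0,\ \rho'_{2F}\le 0,\quad \rho''_{F}\ge 0,\ \rho''_{2F}\ge 0,\quad G''_{F}\ge 0.$$ Then the relation of the stability of the volume-based local model and the fully atomistic model depends on the sign of $$B_F=-\big[\phi''_{2F}+G''_F\big((\rho'_F)^2+20(\rho'_{2F})^2+12\rho'_F\rho'_{2F}\big)+2G'_F\rho''_{2F}\big]$$ and can be summarized as follows: $$\min_{0\le s\le4}\lambda^a_F(s)=\lambda^a_F(0)=\lambda^{c,v}_F\quad\text{if } B_F\ge 0,$$ $$\min_{0\le s\le4}\lambda^a_F(s)=\min\{\lambda^a_F(s^* ),\lambda^a_F(4)\}<\lambda^a_F(0)=\min_{0\le s\le4}\lambda^{c,v}_F\quad\text{if } B_F<0.$$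
   Context: Fix smooth functions $\phi,\rho:(0,\infty)\to\mathbb{R}$ (pair potential, electron density), $G:\mathbb{R}\to\mathbb{R}$ (embedding function), and $F>0$. Notation: $\phi''_F=\phi''(F)$, $\phi''_{2F}=\phi''(2F)$, $\rho'_F=\rho'(F)$, $\rho'_{2F}=\rho'(2F)$, $\rho''_F=\rho''(F)$, $\rho''_{2F}=\rho''(2F)$, and $G'_F=G'(\bar\rho_F)$, $G''_F=G''(\bar\rho_F)$ with $\bar\rho_F=2\rho(F)+2\rho(2F)$. Put $$A_F=4G''_F(\rho'_F+2\rho'_{2F})^2+2G'_F(\rho''_F+4\rho''_{2F})+\phi''_F+4\phi''_{2F},$$ $$C_F=G''_F\big(8(\rho'_{2F})^2+2\rho'_F\rho'_{2F}\big),\qquad D_F=-G''_F(\rho'_{2F})^2,$$ with $B_F$ as in the claim. The sign assumptions are regarded as giving $C_F>0$ and $D_F<0$. The eigenvalue functions are, for $s\in[0,4]$, $\lambda^a_F(s)=A_F+B_Fs+C_Fs^2+D_Fs^3$ (atomistic) and the constant $\lambda^{c,v}_F=A_F$ (volume-based local). The point $$s^*=\frac{C_F-\sqrt{C_F^2-3B_FD_F}}{-3D_F}$$ is the critical point of the cubic $\lambda^a_F$ at which it has its local minimum when $C_F^2-3B_FD_F>0$; when $C_F^2-3B_FD_F\le0$ the expression $\min\{\lambda^a_F(s^* ),\lambda^a_F(4)\}$ is read as $\lambda^a_F(4)$. Interpretation: for a $2N$-periodic chain with spacing $\epsilon=1/N$, uniform deformation $(\mathbf{y}_F)_\ell=F\epsilon\ell$,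 $y'_\ell=(y_\ell-y_{\ell-1})/\epsilon$, the numbers $\lambda^a_F(s_k)$ with $s_k=4\sin^2(k\pi/(2N))$, $k=1,\dots,N$, and the number $\lambda^{c,v}_F$ are the eigenvalues, with respect to the norm $(\epsilon\sum_{\ell=-N+1}^N|u'_\ell|^2)^{1/2}$ on $2N$-periodic mean-zero displacements $\mathbf{u}$, of the second variations at $\mathbf{y}_F$ of the atomistic energy $\mathcal{E}^a(\mathbf{y})=\epsilon\sum_{\ell=-N+1}^N\{G(\rho(y'_\ell)+\rho(y'_\ell+y'_{\ell-1})+\rho(y'_{\ell+1})+\rho(y'_{\ell+1}+y'_{\ell+2}))+\frac12[\phi(y'_\ell)+\phi(y'_\ell+y'_{\ell-1})+\phi(y'_{\ell+1})+\phi(y'_{\ell+1}+y'_{\ell+2})]\}$ and of the volume-based local energy $\mathcal{E}^{c,v}(\mathbf{y})=\epsilon\sum_{\ell=-N+1}^N\{G(2\rho(y'_\ell)+2\rho(2y'_\ell))+\phi(y'_\ell)+\phi(2y'_\ell)\}$, respectively. The number $N$ is assumed sufficiently large, and the minimum over $0\le s\le4$ is used to approximate the minimum over the $s_k$.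
   Formalization: When s* lies outside [0,4] (this can happen, with s*>4), min{λ^a_F(s* ), λ^a_F(4)} is read as λ^a_F(4); with the cubic extended beyond [0,4] the stated equality is false there, since λ^a_F(s* )<λ^a_F(4). *)

theory Defs
  imports "HOL-Analysis.Analysis"
begin

(* C^infinity on an open set S; on such an S the iterated derivatives depend
   only on the values of f on S. *)
definition smooth_on_open :: "(real \<Rightarrow> real) \<Rightarrow> real set \<Rightarrow> bool" where
  "smooth_on_open f S \<longleftrightarrow>
     open S \<and> (\<forall>n. \<forall>x\<in>S. (deriv ^^ n) f differentiable (at x))"

(* m = min {f s | s in S}, including that the minimum is attained *)
definition is_minimum_on :: "real \<Rightarrow> (real \<Rightarrow> real) \<Rightarrow> real set \<Rightarrow> bool" where
  "is_minimum_on m f S \<longleftrightarrow> (\<exists>s\<in>S. f s = m) \<and> (\<forall>s\<in>S. m \<le> f s)"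

definition rho_bar :: "(real \<Rightarrow> real) \<Rightarrow> real \<Rightarrow> real" where
  "rho_bar \<rho> F = 2 * \<rho> F + 2 * \<rho> (2 * F)"

(* In all of the following, \<phi> is the pair potential, \<rho> the electron density,
   G the embedding function and F the uniform deformation gradient. The functions
   \<phi> and \<rho> are only meant to be used on (0, \<infinity>). *)

definition coef_A :: "(real \<Rightarrow> real) \<Rightarrow> (real \<Rightarrow> real) \<Rightarrow> (real \<Rightarrow> real) \<Rightarrow> real \<Rightarrow> real" where
  "coef_A \<phi> \<rho> G F =
     4 * (deriv ^^ 2) G (rho_bar \<rho> F) * (deriv \<rho> F + 2 * deriv \<rho> (2 * F))\<^sup>2
     + 2 * deriv G (rho_bar \<rho> F) * ((deriv ^^ 2) \<rho> F + 4 * (deriv ^^ 2) \<rho> (2 * F))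
     + (deriv ^^ 2) \<phi> F + 4 * (deriv ^^ 2) \<phi> (2 * F)"

definition coef_B :: "(real \<Rightarrow> real) \<Rightarrow> (real \<Rightarrow> real) \<Rightarrow> (real \<Rightarrow> real) \<Rightarrow> real \<Rightarrow> real" where
  "coef_B \<phi> \<rho> G F =
     - ((deriv ^^ 2) \<phi> (2 * F)
        + (deriv ^^ 2) G (rho_bar \<rho> F)
          * ((deriv \<rho> F)\<^sup>2 + 20 * (deriv \<rho> (2 * F))\<^sup>2 + 12 * deriv \<rho> F * deriv \<rho> (2 * F))
        + 2 * deriv G (rho_bar \<rho> F) * (deriv ^^ 2) \<rho> (2 * F))"

definition coef_C :: "(real \<Rightarrow> real) \<Rightarrow> (real \<Rightarrow> real) \<Rightarrow> real \<Rightarrow> real" where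
  "coef_C \<rho> G F =
     (deriv ^^ 2) G (rho_bar \<rho> F)
       * (8 * (deriv \<rho> (2 * F))\<^sup>2 + 2 * deriv \<rho> F * deriv \<rho> (2 * F))"

definition coef_D :: "(real \<Rightarrow> real) \<Rightarrow> (real \<Rightarrow> real) \<Rightarrow> real \<Rightarrow> real" where
  "coef_D \<rho> G F = - ((deriv ^^ 2) G (rho_bar \<rho> F) * (deriv \<rho> (2 * F))\<^sup>2)"

definition lambda_a ::
  "(real \<Rightarrow> real) \<Rightarrow> (real \<Rightarrow> real) \<Rightarrow> (real \<Rightarrow> real) \<Rightarrow> real \<Rightarrow> real \<Rightarrow> real" where
  "lambda_a \<phi> \<rho> G F s =
     coef_A \<phi> \<rho> G F + coef_B \<phi> \<rho> G F * s + coef_C \<rho> G F * s ^ 2 + coef_D \<rho> G F * s ^ 3"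

definition lambda_cv ::
  "(real \<Rightarrow> real) \<Rightarrow> (real \<Rightarrow> real) \<Rightarrow> (real \<Rightarrow> real) \<Rightarrow> real \<Rightarrow> real" where
  "lambda_cv \<phi> \<rho> G F = coef_A \<phi> \<rho> G F"

definition discr :: "(real \<Rightarrow> real) \<Rightarrow> (real \<Rightarrow> real) \<Rightarrow> (real \<Rightarrow> real) \<Rightarrow> real \<Rightarrow> real" where
  "discr \<phi> \<rho> G F = (coef_C \<rho> G F)\<^sup>2 - 3 * coef_B \<phi> \<rho> G F * coef_D \<rho> G F"

definition s_star :: "(real \<Rightarrow> real) \<Rightarrow> (real \<Rightarrow> real) \<Rightarrow> (real \<Rightarrow> real) \<Rightarrow> real \<Rightarrow> real" where
  "s_star \<phi> \<rho> G F = (coef_C \<rho> G F - sqrt (discr \<phi> \<rho> G F)) / (- 3 * coef_D \<rho> G F)"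

(* The expression min {lambda_a (s_star), lambda_a 4}. It is read as lambda_a 4
   when the cubic has no local minimum (discr <= 0), and also when s_star lies
   outside the domain [0, 4] of the eigenvalue function. The latter does occur
   (s_star > 4), and there the value of the cubic at s_star is smaller than its
   minimum over [0, 4]. If coef_D = 0 then coef_C = 0 and discr = 0, so the
   division by zero in s_star is never used. *)
definition min_s_star_4 ::
  "(real \<Rightarrow> real) \<Rightarrow> (real \<Rightarrow> real) \<Rightarrow> (real \<Rightarrow> real) \<Rightarrow> real \<Rightarrow> real" where
  "min_s_star_4 \<phi> \<rho> G F =
     (if discr \<phi> \<rho> G F > 0 \<and> s_star \<phi> \<rho> G F \<in> {0..4}
      then min (lambda_a \<phi> \<rho> G F (s_star \<phi> \<rho> G F)) (lambda_a \<phi> \<rho> G F 4)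
      else lambda_a \<phi> \<rho> G F 4)"

end

theory Submission
  imports Defs
begin

text \<open>
  Since \<open>C \<ge> -8 D \<ge> 0\<close>, the term \<open>s\<^sup>2 (C + D s)\<close> is nonnegative on \<open>[0, 4]\<close>, which settles
  \<open>B \<ge> 0\<close>. If \<open>B < 0\<close>, then either the derivative of the cubic is nonpositive everywhere
  (or the cubic is linear), or it factors as \<open>3 D (x - u) (x - v)\<close> with \<open>0 < u = s\<^sup>* \<le> v\<close>; the
  cubic then decreases up to \<open>u\<close>, increases up to \<open>v\<close> and decreases afterwards, so that its minimum
  over \<open>[0, 4]\<close> sits at \<open>u\<close> or at \<open>4\<close>. Monotonicity follows from Simpson's rule, which is exact for
  cubics.
\<close>

definition cubic :: "real \<Rightarrow> real \<Rightarrow> real \<Rightarrow> real \<Rightarrow> real \<Rightarrow> real" where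
  "cubic a b c d x = a + b * x + c * x ^ 2 + d * x ^ 3"

definition cubic_deriv :: "real \<Rightarrow> real \<Rightarrow> real \<Rightarrow> real \<Rightarrow> real" where
  "cubic_deriv b c d x = b + 2 * c * x + 3 * d * x ^ 2"

lemma cubic_at_0 [simp]: "cubic a b c d 0 = a"
  by (simp add: cubic_def)

text \<open>The integral of the quadratic \<open>cubic_deriv\<close> is written as its exact Simpson
  sum. Monotonicity thus reduces to signs at three points, by pure algebra.\<close>

lemma cubic_diff_Simpson:
  "cubic a b c d y - cubic a b c d x =
     (y - x) / 6 * (cubic_deriv b c d x + 4 * cubic_deriv b c d ((x + y) / 2) + cubic_deriv b c d y)"
  by (simp add: cubic_def cubic_deriv_def field_simps power2_eq_square power3_eq_cube)

lemma cubic_antimono: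
  assumes "x \<le> y" and "\<And>z. x \<le> z \<Longrightarrow> z \<le> y \<Longrightarrow> cubic_deriv b c d z \<le> 0"
  shows "cubic a b c d y \<le> cubic a b c d x"
proof -
  have "cubic_deriv b c d x + 4 * cubic_deriv b c d ((x + y) / 2) + cubic_deriv b c d y \<le> 0"
    using assms(2)[of x] assms(2)[of "(x + y) / 2"] assms(2)[of y] assms(1) by simp
  then have "cubic a b c d y - cubic a b c d x \<le> 0"
    unfolding cubic_diff_Simpson using assms(1) by (intro mult_nonneg_nonpos) auto
  then show ?thesis by simp
qed

text \<open>The left end point has positive weight in the Simpson sum, so strictness there alone
  makes the sum strict.\<close>

lemma cubic_less:
  assumes "x < y" and "\<And>z. x \<le> z \<Longrightarrow> z \<le> y \<Longrightarrow> cubic_deriv b c d z \<le> 0"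
    and "cubic_deriv b c d x < 0"
  shows "cubic a b c d y < cubic a b c d x"
proof -
  have "cubic_deriv b c d x + 4 * cubic_deriv b c d ((x + y) / 2) + cubic_deriv b c d y < 0"
    using assms(2)[of "(x + y) / 2"] assms(2)[of y] assms(1,3) by simp
  then have "cubic a b c d y - cubic a b c d x < 0"
    unfolding cubic_diff_Simpson using assms(1) by (intro mult_pos_neg) auto
  then show ?thesis by simp
qed

text \<open>Serves both when the derivative never becomes positive and when the local minimum lies
  beyond \<open>t\<close>. Strictness comes from the derivative at 0, which is
  \<open>b\<close>.\<close>

lemma cubic_decreasing_minimum:
  assumes "b < 0" and "0 < t" and "\<And>z. 0 \<le> z \<Longrightarrow> z \<le> t \<Longrightarrow> cubic_deriv b c d z \<le> 0"
  shows "is_minimum_on (cubic a b c d t) (cubic a b c d) {0..t} \<and> cubic a b c d t < a"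
proof -
  have "cubic a b c d t \<le> cubic a b c d s" if "s \<in> {0..t}" for s
    using that assms(3) by (intro cubic_antimono) auto
  moreover have "cubic a b c d t < cubic a b c d 0"
    using assms by (intro cubic_less) (auto simp: cubic_deriv_def)
  ultimately show ?thesis
    using assms(2) by (auto simp: is_minimum_on_def intro: bexI[of _ t])
qed

lemma cubic_factored_minimum:
  fixes a b c d u v t :: real
  assumes d: "d < 0" and u: "0 < u" and uv: "u \<le> v" and t: "0 < t"
    and deriv: "\<And>x. cubic_deriv b c d x = 3 * d * (x - u) * (x - v)"
  defines "m \<equiv> (if u \<in> {0..t} then min (cubic a b c d u) (cubic a b c d t) else cubic a b c d t)"
  shows "is_minimum_on m (cubic a b c d) {0..t} \<and> m < a"
proof -
  have b: "b = 3 * d * u * v"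
    using deriv[of 0] by (simp add: cubic_deriv_def)
  have c: "2 * c = - 3 * d * (u + v)"
    using deriv[of 1] b by (simp add: cubic_deriv_def algebra_simps)
  have b_neg: "b < 0"
    using d u uv by (simp add: b mult_neg_pos)
  show ?thesis
  proof (cases "u \<le> t")
    case False
    have "cubic_deriv b c d z \<le> 0" if "0 \<le> z" "z \<le> t" for z
    proof -
      have "0 \<le> (z - u) * (z - v)"
        using that False uv by (intro mult_nonpos_nonpos) auto
      then show ?thesis
        unfolding deriv using d by (simp add: mult.assoc mult_nonpos_nonneg)
    qed
    then show ?thesis
      using cubic_decreasing_minimum[OF b_neg t] False by (simp add: m_def)
  next
    case True
    \<comment> \<open>The cubic minus its value at \<open>u\<close> has a double root at
      \<open>u\<close>. By Vieta its three roots sum to \<open>3 * (u + v) / 2\<close>, so the third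
      is \<open>?r\<close>, where the value at \<open>u\<close> is taken again.\<close>
    let ?r = "(3 * v - u) / 2"
    have diff: "cubic a b c d s - cubic a b c d u = d * (s - u)\<^sup>2 * (s - ?r)" for s
    proof -
      have c': "c = - 3 * d * (u + v) / 2" using c by simp
      show ?thesis
        unfolding cubic_def b c' by (simp add: field_simps power2_eq_square power3_eq_cube)
    qed
    have m: "m = min (cubic a b c d u) (cubic a b c d t)"
      using True u by (simp add: m_def)
    have "m \<le> cubic a b c d s" if s: "s \<in> {0..t}" for s
    proof (cases "s \<le> ?r")
      case True
      then have "0 \<le> d * (s - u)\<^sup>2 * (s - ?r)"
        using d by (intro mult_nonpos_nonpos) (auto simp: mult_nonpos_nonneg)
      then show ?thesis using diff[of s] m by simp
    next
      case False
      \<comment> \<open>Since \<open>u \<le> v\<close> gives \<open>v \<le> ?r\<close>, the cubic is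
        already in its final decreasing phase here, and the right end point \<open>t\<close>
        wins.\<close>
      then have "v \<le> s" using uv by simp
      have "cubic a b c d t \<le> cubic a b c d s"
      proof (rule cubic_antimono)
        show "s \<le> t" using s by simp
        fix z assume "s \<le> z"
        then have "0 \<le> (z - u) * (z - v)" using \<open>v \<le> s\<close> uv by simp
        then show "cubic_deriv b c d z \<le> 0"
          unfolding deriv using d by (simp add: mult.assoc mult_nonpos_nonneg)
      qed
      then show ?thesis using m by simp
    qed
    moreover have "\<exists>s\<in>{0..t}. cubic a b c d s = m"
      using True u t by (auto simp: m min_def)
    moreover have "m < a"
    proof -
      have "0 < d * (0 - u)\<^sup>2 * (0 - ?r)"
        using d u uv by (intro mult_neg_neg) (auto simp: mult_neg_pos)
      then show ?thesis using diff[of 0] m by simp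
    qed
    ultimately show ?thesis by (simp add: is_minimum_on_def)
  qed
qed

text \<open>\<open>\<Delta>\<close> is a quarter of the discriminant of the derivative, and
  \<open>u\<close> is the smaller of its roots. Assumption \<open>cd\<close> excludes a genuine
  parabola: \<open>d = 0\<close> forces \<open>\<Delta> = 0\<close>, hence the branch that does not
  evaluate \<open>u\<close>.\<close>

lemma cubic_minimum:
  fixes a b c d t :: real
  assumes b: "b < 0" and d: "d \<le> 0" and c: "0 \<le> c" and cd: "d = 0 \<Longrightarrow> c = 0" and t: "0 < t"
  defines "\<Delta> \<equiv> c\<^sup>2 - 3 * b * d"
  defines "u \<equiv> (c - sqrt \<Delta>) / (- 3 * d)"
  defines "m \<equiv> (if \<Delta> > 0 \<and> u \<in> {0..t} then min (cubic a b c d u) (cubic a b c d t)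
                else cubic a b c d t)"
  shows "is_minimum_on m (cubic a b c d) {0..t} \<and> m < a"
proof (cases "\<Delta> > 0")
  case False
  have "cubic_deriv b c d z \<le> 0" for z
  proof (cases "d = 0")
    case True
    then show ?thesis using b cd by (simp add: cubic_deriv_def)
  next
    case False
    \<comment> \<open>Completing the square; as \<open>3 * d\<close> is negative, a nonnegative
      product means a nonpositive derivative.\<close>
    have "3 * d * cubic_deriv b c d z = (3 * d * z + c)\<^sup>2 - \<Delta>"
      by (simp add: cubic_deriv_def \<Delta>_def algebra_simps power2_eq_square)
    then have "0 \<le> 3 * d * cubic_deriv b c d z"
      using \<open>\<not> \<Delta> > 0\<close> zero_le_power2[of "3 * d * z + c"] by linarith
    then show ?thesis using False d by (simp add: zero_le_mult_iff)
  qed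
  then show ?thesis
    using cubic_decreasing_minimum[OF b t] False by (simp add: m_def)
next
  case True
  then have d_neg: "d < 0"
    using d cd by (cases "d = 0") (auto simp: \<Delta>_def)
  define v where "v = (c + sqrt \<Delta>) / (- 3 * d)"
  have sq: "sqrt \<Delta> * sqrt \<Delta> = \<Delta>" using True by simp
  \<comment> \<open>\<open>b\<close> and \<open>d\<close> have the same sign, so
    \<open>\<Delta>\<close> is below the square of \<open>c\<close>, which puts the smaller root to
    the right of 0.\<close>
  have "0 < 3 * b * d" using b d_neg by (simp add: mult_neg_neg)
  then have "sqrt \<Delta> < sqrt (c\<^sup>2)"
    by (simp add: \<Delta>_def del: real_sqrt_abs)
  then have "sqrt \<Delta> < c" using c by simp
  then have u_pos: "0 < u" using d_neg by (simp add: u_def divide_pos_neg)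
  have uv: "u \<le> v"
    using d_neg True unfolding u_def v_def by (intro divide_right_mono) auto
  have "cubic_deriv b c d x = 3 * d * (x - u) * (x - v)" for x
  proof -
    have u': "3 * d * u = sqrt \<Delta> - c" and v': "3 * d * v = - (c + sqrt \<Delta>)"
      using d_neg by (simp_all add: u_def v_def field_simps)
    \<comment> \<open>The extra factor \<open>3 * d\<close> clears the denominators of
      \<open>u\<close> and \<open>v\<close>; it is nonzero and cancels at the end.\<close>
    have "3 * d * (3 * d * (x - u) * (x - v)) = (3 * d * x - 3 * d * u) * (3 * d * x - 3 * d * v)"
      by (simp add: algebra_simps)
    also have "\<dots> = (3 * d * x + c)\<^sup>2 - sqrt \<Delta> * sqrt \<Delta>"
      unfolding u' v' by (simp add: algebra_simps power2_eq_square)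
    also have "\<dots> = 3 * d * cubic_deriv b c d x"
      unfolding sq by (simp add: cubic_deriv_def \<Delta>_def algebra_simps power2_eq_square)
    finally show ?thesis using d_neg by simp
  qed
  from cubic_factored_minimum[OF d_neg u_pos uv t this, of a] show ?thesis
    using True by (simp add: m_def)
qed

lemma lambda_a_eq_cubic:
  "lambda_a \<phi> \<rho> G F =
     cubic (coef_A \<phi> \<rho> G F) (coef_B \<phi> \<rho> G F) (coef_C \<rho> G F) (coef_D \<rho> G F)"
  by (simp add: fun_eq_iff lambda_a_def cubic_def)

lemma coef_D_nonpos: "(deriv ^^ 2) G (rho_bar \<rho> F) \<ge> 0 \<Longrightarrow> coef_D \<rho> G F \<le> 0"
  unfolding coef_D_def by simp

text \<open>The mixed product of first derivatives is nonnegative because both factors are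
  nonpositive; the remaining term of \<open>coef_C\<close> is exactly
  \<open>- 8 * coef_D\<close>.\<close>

lemma coef_C_ge:
  assumes "deriv \<rho> F \<le> 0" and "deriv \<rho> (2 * F) \<le> 0" and "(deriv ^^ 2) G (rho_bar \<rho> F) \<ge> 0"
  shows "- 8 * coef_D \<rho> G F \<le> coef_C \<rho> G F"
proof -
  have "0 \<le> deriv \<rho> F * deriv \<rho> (2 * F)"
    using assms(1,2) by (rule mult_nonpos_nonpos)
  then have "0 \<le> (deriv ^^ 2) G (rho_bar \<rho> F) * (2 * (deriv \<rho> F * deriv \<rho> (2 * F)))"
    using assms(3) by (intro mult_nonneg_nonneg[of "(deriv ^^ 2) G (rho_bar \<rho> F)"]) simp_all
  then show ?thesis
    unfolding coef_C_def coef_D_def by (simp add: algebra_simps)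
qed

text \<open>If \<open>coef_D\<close> vanishes, so does one of its factors, and each of them also
  divides \<open>coef_C\<close>. This supplies assumption \<open>cd\<close> of
  \<open>cubic_minimum\<close>.\<close>

lemma coef_C_eq_0: "coef_D \<rho> G F = 0 \<Longrightarrow> coef_C \<rho> G F = 0"
  unfolding coef_C_def coef_D_def by auto

theorem theorem5p1:
  fixes \<phi> \<rho> G :: "real \<Rightarrow> real" and F :: real
  assumes "smooth_on_open \<phi> {0<..}" and "smooth_on_open \<rho> {0<..}" and "smooth_on_open G UNIV"
    and "F > 0"
    and "(deriv ^^ 2) \<phi> F > 0" and "(deriv ^^ 2) \<phi> (2 * F) < 0"
    and "deriv \<rho> F \<le> 0" and "deriv \<rho> (2 * F) \<le> 0"
    and "(deriv ^^ 2) \<rho> F \<ge> 0" and "(deriv ^^ 2) \<rho> (2 * F) \<ge> 0"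
    and "(deriv ^^ 2) G (rho_bar \<rho> F) \<ge> 0"
  shows "(coef_B \<phi> \<rho> G F \<ge> 0 \<longrightarrow>
            is_minimum_on (lambda_a \<phi> \<rho> G F 0) (lambda_a \<phi> \<rho> G F) {0..4} \<and>
            lambda_a \<phi> \<rho> G F 0 = lambda_cv \<phi> \<rho> G F) \<and>
         (coef_B \<phi> \<rho> G F < 0 \<longrightarrow>
            is_minimum_on (min_s_star_4 \<phi> \<rho> G F) (lambda_a \<phi> \<rho> G F) {0..4} \<and>
            min_s_star_4 \<phi> \<rho> G F < lambda_a \<phi> \<rho> G F 0 \<and>
            is_minimum_on (lambda_a \<phi> \<rho> G F 0) (\<lambda>s. lambda_cv \<phi> \<rho> G F) {0..4})"
proof (intro conjI impI)
  let ?A = "coef_A \<phi> \<rho> G F" and ?B = "coef_B \<phi> \<rho> G F" and ?C = "coef_C \<rho> G F" and ?D = "coef_D \<rho> G F"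
  have D: "?D \<le> 0" using assms(11) by (rule coef_D_nonpos)
  have C: "- 8 * ?D \<le> ?C" using assms(7,8,11) by (rule coef_C_ge)
  show "lambda_a \<phi> \<rho> G F 0 = lambda_cv \<phi> \<rho> G F"
    by (simp add: lambda_a_def lambda_cv_def)
  then show "is_minimum_on (lambda_a \<phi> \<rho> G F 0) (\<lambda>s. lambda_cv \<phi> \<rho> G F) {0..4}"
    by (auto simp: is_minimum_on_def)
  show "is_minimum_on (lambda_a \<phi> \<rho> G F 0) (lambda_a \<phi> \<rho> G F) {0..4}" if B: "?B \<ge> 0"
  proof -
    have "?A \<le> lambda_a \<phi> \<rho> G F s" if s: "s \<in> {0..4}" for s
    proof -
      \<comment> \<open>The 8 matches the bound \<open>C\<close>: since \<open>s\<close> stays below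
        8, \<open>?C + s * ?D\<close> cannot become negative.\<close>
      have "8 * ?D \<le> s * ?D"
        using s D by (intro mult_right_mono_neg) auto
      then have "0 \<le> s\<^sup>2 * (?C + s * ?D)"
        using C by simp
      then have "0 \<le> ?C * s ^ 2 + ?D * s ^ 3"
        by (simp add: algebra_simps power2_eq_square power3_eq_cube)
      moreover have "0 \<le> ?B * s" using B s by simp
      ultimately show ?thesis by (simp add: lambda_a_def)
    qed
    moreover have "lambda_a \<phi> \<rho> G F 0 = ?A" by (simp add: lambda_a_def)
    ultimately show ?thesis by (auto simp: is_minimum_on_def)
  qed
  have "is_minimum_on (min_s_star_4 \<phi> \<rho> G F) (lambda_a \<phi> \<rho> G F) {0..4} \<and>
        min_s_star_4 \<phi> \<rho> G F < lambda_a \<phi> \<rho> G F 0" if B: "?B < 0"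
  proof -
    have "0 \<le> ?C" using C D by simp
    show ?thesis
      unfolding min_s_star_4_def s_star_def discr_def lambda_a_eq_cubic cubic_at_0
      by (rule cubic_minimum[OF B D \<open>0 \<le> ?C\<close> coef_C_eq_0]) simp_all
  qed
  then show "is_minimum_on (min_s_star_4 \<phi> \<rho> G F) (lambda_a \<phi> \<rho> G F) {0..4}"
    and "min_s_star_4 \<phi> \<rho> G F < lambda_a \<phi> \<rho> G F 0" if "?B < 0"
    using that by blast+
qed

end
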